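(* Let $\bar\triangle=\{\Delta_1,\dots,\Delta_n\}$ be a strip of triangles and let $\{\bar\triangle,\mathcal A\}$ be an exact problem (i.e. $\mathcal A\subset|\bar\triangle|$ consists of exactly $n+2$ nodes). Then it has a subproblem of type "$3$", "$2+2$", or "$2+1+\cdots+1+2,p$" for some $p\ge1$; that is, there are $1\le k\le m\le n$ such that the problem $\{\bar\triangle_k^m,\mathcal A\cap|\bar\triangle_k^m|\}$ is of one of these types. Moreover, by using line transformations, one either determines that the problem $\{\bar\triangle,\mathcal A\}$ is not poised, or reduces the node set $\mathcal A$ to a node set $\mathcal B$ such that the line-equivalent problem $\{\bar\triangle,\mathcal B\}$ has a basic subproblem, i.e. for some $1\le k\le m\le n$ the problem $\{\bar\triangle_k^m,\mathcal B\cap|\bar\triangle_k^m|\}$ is of type "$3/B$", "$2+2/B$", or "$2+1+\cdots+1+2,p/B$" for some $p\ge1$.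
   Context: A strip of triangles: $n\ge1$ and $V_1,\dots,V_{n+2}$ are points in the plane such that the closed triangles $\Delta_i=[V_i,V_{i+1},V_{i+2}]$, $i=1,\dots,n$, are nondegenerate and: $\Delta_i\cap\Delta_{i+1}$ is exactly the common side $[V_{i+1},V_{i+2}]$; $\Delta_i\cap\Delta_{i+2}=\{V_{i+2}\}$; all other pairs of distinct triangles are disjoint. The strip is $\bar\triangle=\{\Delta_1,\dots,\Delta_n\}$ and $|\bar\triangle|=\bigcup_{i=1}^n\Delta_i$. For $1\le k\le m\le n$, $\bar\triangle_k^m=\{\Delta_k,\dots,\Delta_m\}$, itself a strip, and $|\bar\triangle_k^m|$ is the union of its triangles. The interior sides of a strip are the common sides of its neighboring triangles. $S(\bar\triangle)$ is the linear space of continuous functions $s:|\bar\triangle|\to\mathbb R$ whose restriction to each $\Delta_i$ is a polynomial of total degree at most $1$ in two variables. For a finite node set $\mathcal A=\{A_1,\dots,A_M\}\subset|\bar\triangle|$, the problem $\{\bar\triangle,\mathcal A\}$ is poised if for all real $c_1,\dots,c_M$ there is exactly one $s\in S(\bar\triangle)$ with $s(A_i)=c_i$ for all $i$. Types of problems (a problem is a strip together with a node set in it): - "$3$": the strip is one triangle containing at least three nodes. "$3/B$": the strip is one triangle with exactly three nodes, which are non-collinear. - "$2+2$": the strip has two triangles, each containing exactly two nodes, and no node lies on the interior side. "$2+2/B$": a "$2+2$" problem such that in each triangle the line passing through the two nodes there does not intersect the other triangle. - "$2+1+\cdots+1+2,p$" ($p$ is the number of $1$'s): the strip has $p+2$ triangles;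 the first and the last triangle each contain exactly two nodes, each of the other $p$ triangles contains exactly one node, and no node lies on an interior side of the strip. "$2+1+\cdots+1+2,p/B$": a problem of this type such that the line passing through the two nodes in each of the first and the last triangles does not intersect the neighboring triangle. The problems with "$/B$" are called basic. Line transformation: let $A\ne B$ be two nodes of $\mathcal A$ lying in a common triangle $\Delta_i$, and let $A',B'$ be the points of intersection of the line through $A,B$ with the sides of $\Delta_i$, i.e. the endpoints of the segment in which that line meets $\Delta_i$. The line transformation of $\mathcal A$ with respect to $\{A,B\}$ is the set obtained from $\mathcal A$ by replacing the pair $\{A,B\}$ with $\{A',B'\}$. Two node sets (and the corresponding problems) are line-equivalent if one of the sets can be obtained from the other by several line transformations (possibly none).
   Formalization: In the "/B" types, the line through the two nodes is only required not to meet the neighboring triangle within its own triangle (it misses the common side); read literally, the claim fails for some poised problems on two triangles with nonconvex union. *)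

theory Defs
  imports "HOL-Analysis.Analysis"
begin

text \<open>A strip is given by its vertices \<open>V 1, \<dots>, V (n + 2)\<close>; the other values of \<open>V\<close> are irrelevant.
  The strip consisting of the triangles with indices \<open>k, \<dots>, m\<close> is represented by \<open>V\<close>, \<open>k\<close>, \<open>m\<close>.\<close>

definition triangle :: "(nat \<Rightarrow> real^2) \<Rightarrow> nat \<Rightarrow> (real^2) set" where
  "triangle V i = convex hull {V i, V (i + 1), V (i + 2)}"

definition strip :: "(nat \<Rightarrow> real^2) \<Rightarrow> nat \<Rightarrow> bool" where
  "strip V n \<longleftrightarrow> n \<ge> 1 \<and>
     (\<forall>i\<in>{1..n}. \<not> collinear {V i, V (i + 1), V (i + 2)}) \<and>
     (\<forall>i. 1 \<le> i \<and> i + 1 \<le> n \<longrightarrow>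
        triangle V i \<inter> triangle V (i + 1) = closed_segment (V (i + 1)) (V (i + 2))) \<and>
     (\<forall>i. 1 \<le> i \<and> i + 2 \<le> n \<longrightarrow> triangle V i \<inter> triangle V (i + 2) = {V (i + 2)}) \<and>
     (\<forall>i j. 1 \<le> i \<and> i + 2 < j \<and> j \<le> n \<longrightarrow> triangle V i \<inter> triangle V j = {})"

definition strip_union :: "(nat \<Rightarrow> real^2) \<Rightarrow> nat \<Rightarrow> nat \<Rightarrow> (real^2) set" where
  "strip_union V k m = (\<Union>i\<in>{k..m}. triangle V i)"

definition interior_sides :: "(nat \<Rightarrow> real^2) \<Rightarrow> nat \<Rightarrow> nat \<Rightarrow> (real^2) set set" where
  "interior_sides V k m = {closed_segment (V (i + 1)) (V (i + 2)) | i. k \<le> i \<and> i < m}"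

text \<open>Functions on the union of the strip are represented by extensional functions, so that
  equality of two splines means equality on that union.\<close>

definition splines :: "(nat \<Rightarrow> real^2) \<Rightarrow> nat \<Rightarrow> (real^2 \<Rightarrow> real) set" where
  "splines V n = {s \<in> extensional (strip_union V 1 n).
     continuous_on (strip_union V 1 n) s \<and>
     (\<forall>i\<in>{1..n}. \<exists>a b c. \<forall>x\<in>triangle V i. s x = a + b * x $ 1 + c * x $ 2)}"

definition poised :: "(nat \<Rightarrow> real^2) \<Rightarrow> nat \<Rightarrow> (real^2) set \<Rightarrow> bool" where
  "poised V n N \<longleftrightarrow> (\<forall>c :: real^2 \<Rightarrow> real. \<exists>!s. s \<in> splines V n \<and> (\<forall>x\<in>N. s x = c x))"

definition type_3 :: "(nat \<Rightarrow> real^2) \<Rightarrow> nat \<Rightarrow> nat \<Rightarrow> (real^2) set \<Rightarrow> bool" where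
  "type_3 V k m N \<longleftrightarrow> m = k \<and> N \<subseteq> triangle V k \<and> finite N \<and> card N \<ge> 3"

definition type_3B :: "(nat \<Rightarrow> real^2) \<Rightarrow> nat \<Rightarrow> nat \<Rightarrow> (real^2) set \<Rightarrow> bool" where
  "type_3B V k m N \<longleftrightarrow> m = k \<and> N \<subseteq> triangle V k \<and> card N = 3 \<and> \<not> collinear N"

definition type_22 :: "(nat \<Rightarrow> real^2) \<Rightarrow> nat \<Rightarrow> nat \<Rightarrow> (real^2) set \<Rightarrow> bool" where
  "type_22 V k m N \<longleftrightarrow> m = k + 1 \<and> N \<subseteq> strip_union V k m \<and>
     card (N \<inter> triangle V k) = 2 \<and> card (N \<inter> triangle V m) = 2 \<and>
     (\<forall>s\<in>interior_sides V k m. N \<inter> s = {})"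

definition type_212 :: "nat \<Rightarrow> (nat \<Rightarrow> real^2) \<Rightarrow> nat \<Rightarrow> nat \<Rightarrow> (real^2) set \<Rightarrow> bool" where
  "type_212 p V k m N \<longleftrightarrow> m = k + p + 1 \<and> N \<subseteq> strip_union V k m \<and>
     card (N \<inter> triangle V k) = 2 \<and> card (N \<inter> triangle V m) = 2 \<and>
     (\<forall>i\<in>{k<..<m}. card (N \<inter> triangle V i) = 1) \<and>
     (\<forall>s\<in>interior_sides V k m. N \<inter> s = {})"

text \<open>The line through the two nodes in triangle \<open>i\<close>, followed inside that triangle, does not
  reach the neighbouring triangle \<open>j\<close>; since neighbours intersect in their common side, this means
  that the line misses that side. If two neighbours form a nonconvex quadrilateral, the line
  may leave triangle \<open>i\<close> through another side, cross the gap at the reflex vertex, and meet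
  triangle \<open>j\<close>. This is not counted as an intersection: line transformations never bring a node to
  the common side along such a line, and if it were counted, poised exact problems without any
  line-equivalent problem having a basic subproblem would exist already for two triangles.\<close>

definition node_line_misses ::
    "(nat \<Rightarrow> real^2) \<Rightarrow> (real^2) set \<Rightarrow> nat \<Rightarrow> nat \<Rightarrow> bool" where
  "node_line_misses V N i j \<longleftrightarrow>
     (affine hull (N \<inter> triangle V i) \<inter> triangle V i) \<inter> triangle V j = {}"

definition type_22B :: "(nat \<Rightarrow> real^2) \<Rightarrow> nat \<Rightarrow> nat \<Rightarrow> (real^2) set \<Rightarrow> bool" where
  "type_22B V k m N \<longleftrightarrow> type_22 V k m N \<and>
     node_line_misses V N k m \<and> node_line_misses V N m k"

definition type_212B :: "nat \<Rightarrow> (nat \<Rightarrow> real^2) \<Rightarrow> nat \<Rightarrow> nat \<Rightarrow> (real^2) set \<Rightarrow> bool" where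
  "type_212B p V k m N \<longleftrightarrow> type_212 p V k m N \<and>
     node_line_misses V N k (k + 1) \<and> node_line_misses V N m (m - 1)"

text \<open>The points \<open>P'\<close>, \<open>Q'\<close> are determined up to order as the endpoints of the segment in which
  the line meets the triangle.\<close>

definition line_transformation ::
    "(nat \<Rightarrow> real^2) \<Rightarrow> nat \<Rightarrow> (real^2) set \<Rightarrow> (real^2) set \<Rightarrow> bool" where
  "line_transformation V n N N' \<longleftrightarrow>
     (\<exists>i\<in>{1..n}. \<exists>P\<in>N \<inter> triangle V i. \<exists>Q\<in>N \<inter> triangle V i. P \<noteq> Q \<and>
        (\<exists>P' Q'. affine hull {P, Q} \<inter> triangle V i = closed_segment P' Q' \<and>
                 N' = (N - {P, Q}) \<union> {P', Q'}))"

definition reduces_to ::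
    "(nat \<Rightarrow> real^2) \<Rightarrow> nat \<Rightarrow> (real^2) set \<Rightarrow> (real^2) set \<Rightarrow> bool" where
  "reduces_to V n = rtranclp (line_transformation V n)"

definition line_equivalent ::
    "(nat \<Rightarrow> real^2) \<Rightarrow> nat \<Rightarrow> (real^2) set \<Rightarrow> (real^2) set \<Rightarrow> bool" where
  "line_equivalent V n N N' \<longleftrightarrow> reduces_to V n N N' \<or> reduces_to V n N' N"

end

theory Submission
  imports Defs
begin

text \<open>Call a range of triangles \<open>k, \<dots>, m\<close> overfull if it carries at least two nodes more than
  it has triangles. An exact problem is overfull as a whole, so there is a shortest overfull range.
  If it is a single triangle, that triangle contains three nodes. Otherwise cut the range between
  two neighbours: neither part is overfull, so each carries at most one node more than it has
  triangles, while together they carry at least two more than the whole has triangles. Hence both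
  bounds are attained and no node is counted twice. Comparing consecutive cuts gives the pattern
  \<open>2, 1, \<dots>, 1, 2\<close> with no node on an interior side (\<open>minimal_overfull_pattern\<close>).

  For the second part, let \<open>A\<close> be poised. A line transformation keeps the problem poised, because a
  function that is affine on a triangle takes prescribed values at two points of a line exactly if
  it takes the corresponding values at the two endpoints of the chord (\<open>poised_line_transformation\<close>).
  Among all node sets obtained from \<open>A\<close> and all ranges that are overfull for them, take a shortest
  range. A single triangle is then basic, since the nodes in a triangle of a poised
  problem are affinely independent (\<open>poised_affine_independent\<close>). In a longer range, suppose that
  the line through the two nodes of an end triangle reaches the neighbour. Replacing these nodes by
  the endpoints of their chord puts a new node on the common side (\<open>chord_transformation\<close>). Dropping
  the end triangle now loses one triangle and at most one node, so the shortened range is still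
  overfull (\<open>overfull_transformed\<close>), contradicting the choice. Hence both lines miss the neighbours
  and the subproblem is basic.\<close>

section \<open>Shortest overfull ranges\<close>

text \<open>The range has \<open>m - k + 1\<close> triangles, so the bound is the dimension of its spline space.\<close>

definition overfull :: "(nat \<Rightarrow> real^2) \<Rightarrow> (real^2) set \<Rightarrow> nat \<Rightarrow> nat \<Rightarrow> bool" where
  "overfull V N k m \<longleftrightarrow> m - k + 3 \<le> card (N \<inter> strip_union V k m)"

definition minimal_overfull :: "(nat \<Rightarrow> real^2) \<Rightarrow> (real^2) set \<Rightarrow> nat \<Rightarrow> nat \<Rightarrow> bool" where
  "minimal_overfull V N k m \<longleftrightarrow> overfull V N k m \<and>
     (\<forall>k' m'. k \<le> k' \<and> k' \<le> m' \<and> m' \<le> m \<and> overfull V N k' m' \<longrightarrow> m - k \<le> m' - k')"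

lemma strip_union_single: "strip_union V k k = triangle V k"
  by (simp add: strip_union_def)

lemma triangle_subset_strip_union: "i \<in> {k..m} \<Longrightarrow> triangle V i \<subseteq> strip_union V k m"
  by (auto simp: strip_union_def)

lemma strip_union_split:
  assumes "k \<le> j" "j < m"
  shows "strip_union V k m = strip_union V k j \<union> strip_union V (Suc j) m"
proof -
  have "{k..m} = {k..j} \<union> {Suc j..m}" using assms by auto
  then show ?thesis by (simp add: strip_union_def)
qed

text \<open>Every cut of a minimal overfull range is tight: the upper bounds for the two parts add up
  to the lower bound for the whole.\<close>

lemma minimal_overfull_cut:
  assumes fin: "finite N" and min: "minimal_overfull V N k m"
    and j: "k \<le> j" "j < m"
  shows "card (N \<inter> strip_union V k j) = j - k + 2"
    and "card (N \<inter> strip_union V (Suc j) m) = m - j + 1"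
    and "N \<inter> strip_union V k j \<inter> strip_union V (Suc j) m = {}"
proof -
  let ?L = "N \<inter> strip_union V k j" and ?R = "N \<inter> strip_union V (Suc j) m"
  have part: "\<not> overfull V N k' m'" if "k \<le> k'" "k' \<le> m'" "m' \<le> m" "m' - k' < m - k" for k' m'
    using min that unfolding minimal_overfull_def by (meson not_le)
  have "\<not> overfull V N k j" using part[of k j] j by auto
  then have L: "card ?L \<le> j - k + 2" by (simp add: overfull_def)
  have "\<not> overfull V N (Suc j) m" using part[of "Suc j" m] j by auto
  then have R: "card ?R \<le> m - j + 1" using j by (simp add: overfull_def)
  have "?L \<union> ?R = N \<inter> strip_union V k m" by (auto simp: strip_union_split[OF j])
  then have U: "m - k + 3 \<le> card (?L \<union> ?R)" using min by (simp add: minimal_overfull_def overfull_def)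
  have E: "card ?L + card ?R = card (?L \<union> ?R) + card (?L \<inter> ?R)"
    using fin by (intro card_Un_Int) auto
  show "card ?L = j - k + 2" "card ?R = m - j + 1" using L R U E j by linarith+
  have "card (?L \<inter> ?R) = 0" using L R U E j by linarith
  then show "N \<inter> strip_union V k j \<inter> strip_union V (Suc j) m = {}" using fin by auto
qed

lemma strip_side:
  assumes "strip V n" "1 \<le> i" "i < n"
  shows "triangle V i \<inter> triangle V (Suc i) = closed_segment (V (i + 1)) (V (i + 2))"
  using assms by (auto simp: strip_def)

text \<open>The node count of a middle triangle is the difference of two consecutive tight bounds. A node
  on an interior side would be counted in both parts of the cut along that side.\<close>

lemma minimal_overfull_pattern:
  assumes st: "strip V n" and km: "1 \<le> k" "k < m" "m \<le> n"
    and fin: "finite N" and min: "minimal_overfull V N k m"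
  shows "card (N \<inter> triangle V k) = 2" "card (N \<inter> triangle V m) = 2"
    and "\<And>i. i \<in> {k<..<m} \<Longrightarrow> card (N \<inter> triangle V i) = 1"
    and "\<And>s. s \<in> interior_sides V k m \<Longrightarrow> N \<inter> s = {}"
proof -
  note cut = minimal_overfull_cut[OF fin min]
  show "card (N \<inter> triangle V k) = 2"
    using cut(1)[of k] km by (simp add: strip_union_single)
  show "card (N \<inter> triangle V m) = 2"
    using cut(2)[of "m - 1"] km by (simp add: strip_union_single)
  show "card (N \<inter> triangle V i) = 1" if i: "i \<in> {k<..<m}" for i
  proof -
    have U: "N \<inter> strip_union V k i = (N \<inter> strip_union V k (i - 1)) \<union> (N \<inter> triangle V i)"
      using strip_union_split[of k "i - 1" i V] i by (auto simp: strip_union_single)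
    have "N \<inter> strip_union V k (i - 1) \<inter> triangle V i = {}"
    proof -
      have "k \<le> i - 1" "i - 1 < m" "Suc (i - 1) = i" using i by auto
      then show ?thesis using cut(3)[of "i - 1"] i triangle_subset_strip_union[of i i m V] by auto
    qed
    then have "card (N \<inter> strip_union V k i) = card (N \<inter> strip_union V k (i - 1)) + card (N \<inter> triangle V i)"
      unfolding U using fin by (intro card_Un_disjoint) auto
    then show ?thesis using cut(1)[of i] cut(1)[of "i - 1"] i by auto
  qed
  show "N \<inter> s = {}" if s: "s \<in> interior_sides V k m" for s
  proof -
    obtain i where i: "k \<le> i" "i < m" "s = closed_segment (V (i + 1)) (V (i + 2))"
      using s by (auto simp: interior_sides_def)
    have "s = triangle V i \<inter> triangle V (Suc i)"
      using strip_side[OF st, of i] i km by auto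
    moreover have "triangle V i \<subseteq> strip_union V k i" "triangle V (Suc i) \<subseteq> strip_union V (Suc i) m"
      using i by (auto intro!: triangle_subset_strip_union)
    ultimately show ?thesis using cut(3)[OF i(1,2)] by blast
  qed
qed

lemma minimal_overfull_type:
  assumes st: "strip V n" and km: "1 \<le> k" "k \<le> m" "m \<le> n"
    and fin: "finite N" and min: "minimal_overfull V N k m"
  shows "k = m \<and> type_3 V k m (N \<inter> strip_union V k m) \<or>
    m = k + 1 \<and> type_22 V k m (N \<inter> strip_union V k m) \<or>
    k < m \<and> (\<exists>p\<ge>1. type_212 p V k m (N \<inter> strip_union V k m))"
proof (cases "k = m")
  case True
  then show ?thesis using min fin
    by (auto simp: type_3_def minimal_overfull_def overfull_def strip_union_single)
next
  case False
  then have lt: "k < m" using km by simp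
  note pat = minimal_overfull_pattern[OF st km(1) lt km(3) fin min]
  have restr: "N \<inter> strip_union V k m \<inter> triangle V i = N \<inter> triangle V i" if "i \<in> {k..m}" for i
    using triangle_subset_strip_union[OF that] by blast
  show ?thesis
  proof (cases "m = k + 1")
    case True
    then have "type_22 V k m (N \<inter> strip_union V k m)"
      unfolding type_22_def using pat(1,2,4) restr[of k] restr[of m] by auto
    then show ?thesis using True by blast
  next
    case False
    then have "type_212 (m - k - 1) V k m (N \<inter> strip_union V k m)"
      unfolding type_212_def using pat lt by (auto simp: restr)
    moreover have "m - k - 1 \<ge> 1" using False lt by simp
    ultimately show ?thesis using lt by blast
  qed
qed

section \<open>Splines along lines\<close>

lemma spline_affine_on_triangle:
  assumes s: "s \<in> splines V n" and i: "i \<in> {1..n}"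
    and xy: "x \<in> triangle V i" "y \<in> triangle V i" "(1 - t) *\<^sub>R x + t *\<^sub>R y \<in> triangle V i"
  shows "s ((1 - t) *\<^sub>R x + t *\<^sub>R y) = (1 - t) * s x + t * s y"
proof -
  obtain a b c where abc: "\<And>z. z \<in> triangle V i \<Longrightarrow> s z = a + b * z $ 1 + c * z $ 2"
    using s i unfolding splines_def by blast
  show ?thesis unfolding abc[OF xy(1)] abc[OF xy(2)] abc[OF xy(3)] by (simp add: algebra_simps)
qed

text \<open>On the line through \<open>P\<close> and \<open>Q\<close> inside the triangle a spline is determined by its values at
  any two distinct points. So interpolation data on the new nodes translate into data on the
  old ones with the same solutions.\<close>

lemma poised_line_transformation:
  assumes p: "poised V n N" and tr: "line_transformation V n N N'"
  shows "poised V n N'"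
proof -
  obtain i P Q P' Q' where i: "i \<in> {1..n}" and PQ: "P \<in> N \<inter> triangle V i" "Q \<in> N \<inter> triangle V i" "P \<noteq> Q"
    and ch: "affine hull {P, Q} \<inter> triangle V i = closed_segment P' Q'"
    and N': "N' = (N - {P, Q}) \<union> {P', Q'}"
    using tr unfolding line_transformation_def by blast
  have "P \<in> closed_segment P' Q'" "Q \<in> closed_segment P' Q'"
    using PQ ch hull_subset[of "{P, Q}" affine] by blast+
  then obtain t u where t: "P = (1 - t) *\<^sub>R P' + t *\<^sub>R Q'" and u: "Q = (1 - u) *\<^sub>R P' + u *\<^sub>R Q'"
    by (auto simp: in_segment)
  have tu: "t \<noteq> u" using t u PQ(3) by auto
  have in': "P' \<in> triangle V i" "Q' \<in> triangle V i"
    using ch ends_in_segment[of P' Q'] by blast+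
  show ?thesis unfolding poised_def
  proof
    fix c :: "real^2 \<Rightarrow> real"
    \<comment> \<open>On \<open>P\<close> and \<open>Q\<close> the new data are read off the affine function with the values of \<open>c\<close> at \<open>P'\<close>
      and \<open>Q'\<close>.\<close>
    define d where "d x = (if x = P then (1 - t) * c P' + t * c Q'
        else if x = Q then (1 - u) * c P' + u * c Q' else c x)" for x
    have "(\<forall>x\<in>N. s x = d x) \<longleftrightarrow> (\<forall>x\<in>N'. s x = c x)" if s: "s \<in> splines V n" for s
    proof -
      have sP: "s P = (1 - t) * s P' + t * s Q'"
        unfolding t using PQ(1) t by (intro spline_affine_on_triangle[OF s i in']) simp
      have sQ: "s Q = (1 - u) * s P' + u * s Q'"
        unfolding u using PQ(2) u by (intro spline_affine_on_triangle[OF s i in']) simp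
      have "s P = d P \<and> s Q = d Q \<longleftrightarrow> s P' = c P' \<and> s Q' = c Q'"
      proof
        assume *: "s P = d P \<and> s Q = d Q"
        \<comment> \<open>The errors at the endpoints; the affine function interpolating them along the chord
          vanishes at the two distinct parameters \<open>t\<close> and \<open>u\<close>.\<close>
        define p q where "p = s P' - c P'" and "q = s Q' - c Q'"
        have pq: "(1 - t) * p + t * q = 0" "(1 - u) * p + u * q = 0"
          using * sP sQ PQ(3) by (auto simp: d_def p_def q_def algebra_simps)
        have "(t - u) * (q - p) = 0" using pq by (simp add: algebra_simps)
        then have "q = p" using tu by simp
        then have "p = 0" "q = 0" using pq by (auto simp: algebra_simps)
        then show "s P' = c P' \<and> s Q' = c Q'" by (simp add: p_def q_def)
      next
        assume "s P' = c P' \<and> s Q' = c Q'"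
        then show "s P = d P \<and> s Q = d Q" using sP sQ PQ(3) by (simp add: d_def)
      qed
      moreover have "(\<forall>x\<in>N. s x = d x) \<longleftrightarrow> s P = d P \<and> s Q = d Q \<and> (\<forall>x\<in>N - {P, Q}. s x = c x)"
        using PQ by (auto simp: d_def)
      moreover have "(\<forall>x\<in>N'. s x = c x) \<longleftrightarrow> s P' = c P' \<and> s Q' = c Q' \<and> (\<forall>x\<in>N - {P, Q}. s x = c x)"
        by (auto simp: N')
      ultimately show ?thesis by blast
    qed
    then have eq: "s \<in> splines V n \<and> (\<forall>x\<in>N'. s x = c x) \<longleftrightarrow> s \<in> splines V n \<and> (\<forall>x\<in>N. s x = d x)" for s
      by blast
    show "\<exists>!s. s \<in> splines V n \<and> (\<forall>x\<in>N'. s x = c x)"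
      unfolding eq by (rule p[unfolded poised_def, rule_format])
  qed
qed

text \<open>If a node were an affine combination of the others in its triangle, a spline vanishing at the
  others would vanish there too, so the value \<open>1\<close> could not be prescribed.\<close>

lemma poised_affine_independent:
  assumes p: "poised V n N" and i: "i \<in> {1..n}"
  shows "\<not> affine_dependent (N \<inter> triangle V i)"
proof
  assume "affine_dependent (N \<inter> triangle V i)"
  then obtain e where e: "e \<in> N" "e \<in> triangle V i" "e \<in> affine hull (N \<inter> triangle V i - {e})"
    by (auto simp: affine_dependent_def)
  obtain s where s: "s \<in> splines V n" and sN: "\<And>x. x \<in> N \<Longrightarrow> s x = (if x = e then 1 else 0)"
    using p[unfolded poised_def, rule_format, of "\<lambda>x. if x = e then 1 else 0"] by auto
  obtain a b c where abc: "\<And>z. z \<in> triangle V i \<Longrightarrow> s z = a + b * z $ 1 + c * z $ 2"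
    using s i unfolding splines_def by blast
  let ?Z = "{z :: real^2. a + b * z $ 1 + c * z $ 2 = 0}"
  have "affine ?Z"
  proof (unfold affine_def, intro ballI allI impI)
    fix x y u v assume "x \<in> ?Z" "y \<in> ?Z" "u + v = (1::real)"
    moreover have "a + b * (u *\<^sub>R x + v *\<^sub>R y) $ 1 + c * (u *\<^sub>R x + v *\<^sub>R y) $ 2
        = u * (a + b * x $ 1 + c * x $ 2) + v * (a + b * y $ 1 + c * y $ 2) + a * (1 - (u + v))"
      by (simp add: algebra_simps)
    ultimately show "u *\<^sub>R x + v *\<^sub>R y \<in> ?Z" by simp
  qed
  moreover have "N \<inter> triangle V i - {e} \<subseteq> ?Z"
    using sN abc by fastforce
  ultimately have "affine hull (N \<inter> triangle V i - {e}) \<subseteq> ?Z"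
    by (intro hull_minimal)
  then have "s e = 0" using e abc by auto
  then show False using sN[OF e(1)] by simp
qed

lemma poised_type_3_basic:
  assumes p: "poised V n N" and i: "i \<in> {1..n}" and T: "type_3 V i i (N \<inter> triangle V i)"
  shows "type_3B V i i (N \<inter> triangle V i)"
proof -
  let ?T = "N \<inter> triangle V i"
  have ind: "\<not> affine_dependent ?T" by (rule poised_affine_independent[OF p i])
  have c3: "card ?T \<ge> 3" using T by (simp add: type_3_def)
  have dim: "aff_dim ?T = int (card ?T) - 1" using affine_independent_iff_card ind by blast
  moreover have "aff_dim ?T \<le> 2" using aff_dim_le_DIM[of ?T] by simp
  ultimately have "card ?T = 3" using c3 by linarith
  moreover have "\<not> collinear ?T" unfolding collinear_aff_dim using dim c3 by linarith
  ultimately show ?thesis by (simp add: type_3B_def)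
qed

section \<open>Moving a node to the common side\<close>

text \<open>The side is a face of the triangle. A relatively interior point of the chord
  on the side would therefore put the whole chord on the side, and with it the two nodes, whereas
  no node lies there. So the chord meets the side in one of its endpoints.\<close>

lemma chord_transformation:
  assumes i: "i \<in> {1..n}" and N: "N \<inter> triangle V i = {P, Q}" and PQ: "P \<noteq> Q"
    and F: "F face_of triangle V i" and NF: "N \<inter> F = {}"
    and meet: "affine hull {P, Q} \<inter> triangle V i \<inter> F \<noteq> {}"
  obtains X Y where "X \<in> F" "line_transformation V n N ((N - {P, Q}) \<union> {X, Y})"
proof -
  let ?C = "affine hull {P, Q} \<inter> triangle V i"
  have "compact (triangle V i)" "convex (triangle V i)"
    by (auto simp: triangle_def intro: finite_imp_compact_convex_hull)
  then have C: "compact ?C" "convex ?C"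
    by (auto intro!: closed_Int_compact convex_Int[OF affine_imp_convex])
  have "collinear ?C"
    by (meson collinear_affine_hull_collinear collinear_2 collinear_subset inf_le1)
  moreover have "?C \<noteq> {}" using meet by blast
  ultimately obtain P' Q' where ch: "?C = closed_segment P' Q'"
    using compact_convex_collinear_segment C by metis
  obtain X where X: "X \<in> F" "X \<in> closed_segment P' Q'" using meet ch by blast
  have end_X: "X = P' \<or> X = Q'"
  proof (rule ccontr)
    assume "\<not> (X = P' \<or> X = Q')"
    then have "X \<in> open_segment P' Q'" using X by (simp add: open_segment_def)
    moreover have "P' \<in> triangle V i" "Q' \<in> triangle V i"
      using ch ends_in_segment[of P' Q'] by blast+
    ultimately have "P' \<in> F" "Q' \<in> F" using face_ofD[OF F] X(1) by blast+
    then have "closed_segment P' Q' \<subseteq> F"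
      using face_of_imp_convex[OF F] by (simp add: closed_segment_subset)
    moreover have "P \<in> ?C" using N hull_subset[of "{P, Q}" affine] by blast
    ultimately show False using ch NF N by blast
  qed
  have tr: "line_transformation V n N ((N - {P, Q}) \<union> {P', Q'})"
    unfolding line_transformation_def using i N PQ ch by blast
  show ?thesis using end_X that[of P' Q'] that[of Q' P'] X tr
    by (metis insert_commute)
qed

text \<open>Passing to the shortened range \<open>k'\<close>, \<open>m'\<close> loses the nodes \<open>P\<close> and \<open>Q\<close> of the dropped triangle
  but gains \<open>X\<close>, which was not a node before.\<close>

lemma overfull_transformed:
  assumes fin: "finite N" and full: "overfull V N k m" and len: "m - k = Suc (m' - k')"
    and U: "strip_union V k m = triangle V i \<union> strip_union V k' m'"
    and N: "N \<inter> triangle V i = {P, Q}"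
    and X: "X \<in> strip_union V k' m'" "X \<notin> N"
  shows "overfull V ((N - {P, Q}) \<union> {X, Y}) k' m'"
proof -
  let ?M = "N \<inter> strip_union V k m" and ?B = "((N - {P, Q}) \<union> {X, Y}) \<inter> strip_union V k' m'"
  have "insert X (?M - {P, Q}) \<subseteq> ?B" using U N X by blast
  then have le: "card (insert X (?M - {P, Q})) \<le> card ?B" using fin by (intro card_mono) auto
  have "card (insert X (?M - {P, Q})) = Suc (card (?M - {P, Q}))" using fin X by simp
  moreover have "card ?M - card {P, Q} \<le> card (?M - {P, Q})" by (rule diff_card_le_card_Diff) simp
  moreover have "card {P, Q} \<le> 2" by (simp add: card_insert_if)
  ultimately show ?thesis using le full len by (simp add: overfull_def)
qed

lemma sides_face_of_triangle:
  assumes "strip V n" "1 \<le> i" "i < n"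
  shows "triangle V i \<inter> triangle V (Suc i) face_of triangle V i"
    and "triangle V i \<inter> triangle V (Suc i) face_of triangle V (Suc i)"
proof -
  have side: "triangle V i \<inter> triangle V (Suc i) = convex hull {V (i + 1), V (i + 2)}"
    using strip_side[OF assms] by (simp add: segment_convex_hull)
  have nc: "\<not> affine_dependent {V j, V (j + 1), V (j + 2)}" if "j \<in> {1..n}" for j
    using assms(1) that affine_dependent_imp_collinear_3 unfolding strip_def by blast
  show "triangle V i \<inter> triangle V (Suc i) face_of triangle V i"
    unfolding side unfolding triangle_def
    by (subst face_of_convex_hull_affine_independent[OF nc])
      (use assms in \<open>auto intro!: exI[of _ "{V (i + 1), V (i + 2)}"]\<close>)
  show "triangle V i \<inter> triangle V (Suc i) face_of triangle V (Suc i)"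
    unfolding side unfolding triangle_def
    by (subst face_of_convex_hull_affine_independent[OF nc])
      (use assms in \<open>auto intro!: exI[of _ "{V (i + 1), V (i + 2)}"]\<close>)
qed

text \<open>The two ends of the range are treated alike: \<open>i\<close> is the end triangle, \<open>j\<close> its neighbour, and
  \<open>k'\<close>, \<open>m'\<close> is the range without \<open>i\<close>.\<close>

lemma shorten_or_miss:
  assumes i: "i \<in> {1..n}" and fin: "finite N" and full: "overfull V N k m"
    and len: "m - k = Suc (m' - k')"
    and U: "strip_union V k m = triangle V i \<union> strip_union V k' m'"
    and two: "card (N \<inter> triangle V i) = 2"
    and face: "triangle V i \<inter> triangle V j face_of triangle V i"
    and side: "N \<inter> (triangle V i \<inter> triangle V j) = {}"
    and j: "triangle V j \<subseteq> strip_union V k' m'"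
    and hit: "\<not> node_line_misses V (N \<inter> strip_union V k m) i j"
  obtains N' where "line_transformation V n N N'" "finite N'" "overfull V N' k' m'"
proof -
  obtain P Q where PQ: "N \<inter> triangle V i = {P, Q}" "P \<noteq> Q"
    using two unfolding card_2_iff by blast
  have eq: "N \<inter> strip_union V k m \<inter> triangle V i = {P, Q}" using PQ(1) U by blast
  have "affine hull {P, Q} \<inter> triangle V i \<inter> (triangle V i \<inter> triangle V j) \<noteq> {}"
    using hit unfolding node_line_misses_def eq by blast
  then obtain X Y where X: "X \<in> triangle V i \<inter> triangle V j"
    and tr: "line_transformation V n N ((N - {P, Q}) \<union> {X, Y})"
    using chord_transformation[OF i PQ face side] by blast
  have "X \<notin> N" "X \<in> strip_union V k' m'" using X side j by blast+
  then have "overfull V ((N - {P, Q}) \<union> {X, Y}) k' m'"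
    using overfull_transformed[OF fin full len U PQ(1)] by blast
  then show ?thesis using that[OF tr] fin by simp
qed

section \<open>The subproblem theorem\<close>

theorem theorem6p1:
  fixes V :: "nat \<Rightarrow> real^2" and n :: nat and A :: "(real^2) set"
  assumes "strip V n"
    and "finite A" and "A \<subseteq> strip_union V 1 n" and "card A = n + 2"
  shows "(\<exists>k m. 1 \<le> k \<and> k \<le> m \<and> m \<le> n \<and>
            (type_3 V k m (A \<inter> strip_union V k m) \<or>
             type_22 V k m (A \<inter> strip_union V k m) \<or>
             (\<exists>p\<ge>1. type_212 p V k m (A \<inter> strip_union V k m)))) \<and>
         (\<not> poised V n A \<or>
          (\<exists>B. reduces_to V n A B \<and> line_equivalent V n A B \<and>
            (\<exists>k m. 1 \<le> k \<and> k \<le> m \<and> m \<le> n \<and>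
               (type_3B V k m (B \<inter> strip_union V k m) \<or>
                type_22B V k m (B \<inter> strip_union V k m) \<or>
                (\<exists>p\<ge>1. type_212B p V k m (B \<inter> strip_union V k m))))))"
proof (intro conjI)
  have n: "1 \<le> n" using assms(1) by (simp add: strip_def)
  have full: "overfull V A 1 n"
    using assms(3,4) n by (simp add: overfull_def inf_absorb1)
  show "\<exists>k m. 1 \<le> k \<and> k \<le> m \<and> m \<le> n \<and>
            (type_3 V k m (A \<inter> strip_union V k m) \<or>
             type_22 V k m (A \<inter> strip_union V k m) \<or>
             (\<exists>p\<ge>1. type_212 p V k m (A \<inter> strip_union V k m)))"
  proof -
    let ?R = "\<lambda>(k, m). 1 \<le> k \<and> k \<le> m \<and> m \<le> n \<and> overfull V A k m"
    have "?R (1, n)" using n full by simp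
    from ex_has_least_nat[of ?R, OF this, of "\<lambda>(k, m). m - k"]
    obtain k m where km: "1 \<le> k" "k \<le> m" "m \<le> n" "overfull V A k m"
      and min: "\<And>k' m'. 1 \<le> k' \<Longrightarrow> k' \<le> m' \<Longrightarrow> m' \<le> n \<Longrightarrow> overfull V A k' m' \<Longrightarrow> m - k \<le> m' - k'"
      by auto
    have "minimal_overfull V A k m"
      unfolding minimal_overfull_def using km min by (meson order_trans)
    from minimal_overfull_type[OF assms(1) km(1-3) assms(2) this]
    show ?thesis using km by blast
  qed
  show "\<not> poised V n A \<or>
          (\<exists>B. reduces_to V n A B \<and> line_equivalent V n A B \<and>
            (\<exists>k m. 1 \<le> k \<and> k \<le> m \<and> m \<le> n \<and>
               (type_3B V k m (B \<inter> strip_union V k m) \<or>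
                type_22B V k m (B \<inter> strip_union V k m) \<or>
                (\<exists>p\<ge>1. type_212B p V k m (B \<inter> strip_union V k m)))))"
  proof (cases "poised V n A")
    case False
    then show ?thesis by simp
  next
    case True
    let ?R = "\<lambda>(B, k, m). reduces_to V n A B \<and> poised V n B \<and> finite B \<and>
        1 \<le> k \<and> k \<le> m \<and> m \<le> n \<and> overfull V B k m"
    have "?R (A, 1, n)" using n full True assms(2) by (simp add: reduces_to_def)
    from ex_has_least_nat[of ?R, OF this, of "\<lambda>(B, k, m). m - k"]
    obtain B k m where B: "reduces_to V n A B" "poised V n B" "finite B"
      and km: "1 \<le> k" "k \<le> m" "m \<le> n" "overfull V B k m"
      and min: "\<And>B' k' m'. reduces_to V n A B' \<Longrightarrow> poised V n B' \<Longrightarrow> finite B' \<Longrightarrow>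
        1 \<le> k' \<Longrightarrow> k' \<le> m' \<Longrightarrow> m' \<le> n \<Longrightarrow> overfull V B' k' m' \<Longrightarrow> m - k \<le> m' - k'"
      by auto
    have step: "m - k \<le> m' - k'"
      if "line_transformation V n B B'" "finite B'" "1 \<le> k'" "k' \<le> m'" "m' \<le> n" "overfull V B' k' m'"
      for B' k' m'
    proof -
      have "reduces_to V n A B'"
        using B(1) that(1) unfolding reduces_to_def by (rule rtranclp.rtrancl_into_rtrancl)
      then show ?thesis using min poised_line_transformation[OF B(2) that(1)] that by blast
    qed
    have minB: "minimal_overfull V B k m"
      unfolding minimal_overfull_def using km B min by (meson order_trans)
    note type = minimal_overfull_type[OF assms(1) km(1-3) B(3) minB]
    have miss: "node_line_misses V (B \<inter> strip_union V k m) k (k + 1)"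
        "node_line_misses V (B \<inter> strip_union V k m) m (m - 1)" if lt: "k < m"
    proof -
      note pat = minimal_overfull_pattern[OF assms(1) km(1) lt km(3) B(3) minB]
      have side: "B \<inter> (triangle V i \<inter> triangle V (Suc i)) = {}" if i: "k \<le> i" "i < m" for i
      proof -
        have "closed_segment (V (i + 1)) (V (i + 2)) \<in> interior_sides V k m"
          using i by (auto simp: interior_sides_def)
        then show ?thesis using pat(4) strip_side[OF assms(1), of i] i km by auto
      qed
      show "node_line_misses V (B \<inter> strip_union V k m) k (k + 1)"
      proof (rule ccontr)
        assume hit: "\<not> node_line_misses V (B \<inter> strip_union V k m) k (k + 1)"
        obtain B' where "line_transformation V n B B'" "finite B'" "overfull V B' (k + 1) m"
        proof (rule shorten_or_miss[where n = n, OF _ B(3) km(4) _ _ pat(1) _ _ _ hit])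
          show "strip_union V k m = triangle V k \<union> strip_union V (k + 1) m"
            using strip_union_split[of k k m V] lt by (simp add: strip_union_single)
          show "triangle V k \<inter> triangle V (k + 1) face_of triangle V k"
            using sides_face_of_triangle(1)[OF assms(1), of k] km lt by simp
          show "B \<inter> (triangle V k \<inter> triangle V (k + 1)) = {}" using side[of k] lt by simp
          show "triangle V (k + 1) \<subseteq> strip_union V (k + 1) m"
            using lt by (intro triangle_subset_strip_union) simp
        qed (use km lt in auto)
        then show False using step[of B' "k + 1" m] km lt by simp
      qed
      show "node_line_misses V (B \<inter> strip_union V k m) m (m - 1)"
      proof (rule ccontr)
        assume hit: "\<not> node_line_misses V (B \<inter> strip_union V k m) m (m - 1)"
        have m: "Suc (m - 1) = m" using lt by simp
        obtain B' where "line_transformation V n B B'" "finite B'" "overfull V B' k (m - 1)"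
        proof (rule shorten_or_miss[where n = n, OF _ B(3) km(4) _ _ pat(2) _ _ _ hit])
          show "strip_union V k m = triangle V m \<union> strip_union V k (m - 1)"
            using strip_union_split[of k "m - 1" m V] lt by (simp add: strip_union_single Un_commute)
          show "triangle V m \<inter> triangle V (m - 1) face_of triangle V m"
            using sides_face_of_triangle(2)[OF assms(1), of "m - 1"] km lt
            by (simp add: m Int_commute)
          show "B \<inter> (triangle V m \<inter> triangle V (m - 1)) = {}"
            using side[of "m - 1"] lt by (simp add: m Int_commute)
          show "triangle V (m - 1) \<subseteq> strip_union V k (m - 1)"
            using lt by (intro triangle_subset_strip_union) simp
        qed (use km lt in auto)
        moreover have "k \<le> m - 1" "m - 1 \<le> n" using km lt by linarith+
        ultimately have "m - k \<le> m - 1 - k" using step km(1) by blast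
        then show False using lt by linarith
      qed
    qed
    have "type_3B V k m (B \<inter> strip_union V k m) \<or>
        type_22B V k m (B \<inter> strip_union V k m) \<or>
        (\<exists>p\<ge>1. type_212B p V k m (B \<inter> strip_union V k m))"
      using type
    proof (elim disjE conjE)
      assume "k = m" "type_3 V k m (B \<inter> strip_union V k m)"
      then show ?thesis using poised_type_3_basic[OF B(2), of k] km by (simp add: strip_union_single)
    next
      assume "m = k + 1" "type_22 V k m (B \<inter> strip_union V k m)"
      then show ?thesis using miss by (simp add: type_22B_def)
    next
      assume "k < m" "\<exists>p\<ge>1. type_212 p V k m (B \<inter> strip_union V k m)"
      then show ?thesis using miss by (auto simp: type_212B_def)
    qed
    moreover have "line_equivalent V n A B" using B(1) by (simp add: line_equivalent_def)
    ultimately show ?thesis using B(1) km by blast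
  qed
qed

end
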